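(* Let $k\ge1$ and let $V$ be any level $k$ integrable module of $U_q(\hat{\mathfrak{sl}}(2))$. Then the correlation functions of $x^+(z)x^+(w)$ on $V$ have at most poles at $zq^{-2}=w$ (that is, they have no poles with $z,w\neq0$ other than possibly along $zq^{-2}=w$).
   Context: Here $q$ is generic (a formal parameter; the base field is $\mathbb{C}(q)$ with $q^{1/2}$ adjoined). Drinfeld's current realization: $U_q(\hat{\mathfrak{sl}}(2))$ is the associative unital algebra with generators $\varphi(-m),\psi(m)$ ($m\in\mathbb{Z}_{\ge0}$), $x^{\pm}(l)$ ($l\in\mathbb{Z}$) and a central element $c$ (entering through $q^{\pm c/2}$), with $\varphi(0),\psi(0)$ invertible and mutually inverse. Put $x^{\pm}(z)=\sum_{l\in\mathbb{Z}}x^{\pm}(l)z^{-l}$, $\varphi(z)=\sum_{m\in-\mathbb{Z}_{\ge0}}\varphi(m)z^{-m}$, $\psi(z)=\sum_{m\in\mathbb{Z}_{\ge0}}\psi(m)z^{-m}$. The defining relations are - $\varphi(z)\varphi(w)=\varphi(w)\varphi(z)$, $\psi(z)\psi(w)=\psi(w)\psi(z)$, - $\varphi(z)\psi(w)\varphi(z)^{-1}\psi(w)^{-1}=\dfrac{g(\frac zw q^{-c})}{g(\frac zw q^{c})}$, - $\varphi(z)x^{\pm}(w)\varphi(z)^{-1}=g(\frac zw q^{\mp c/2})^{\pm1}x^{\pm}(w)$, - $\psi(z)x^{\pm}(w)\psi(z)^{-1}=g(\frac wz q^{\mp c/2})^{\mp1}x^{\pm}(w)$, - $[x^+(z),x^-(w)]=\frac{1}{q-q^{-1}}\{\delta(\frac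 zw q^{-c})\psi(wq^{c/2})-\delta(\frac zw q^{c})\varphi(zq^{c/2})\}$, - $(z-q^{\pm2}w)x^{\pm}(z)x^{\pm}(w)=(q^{\pm2}z-w)x^{\pm}(w)x^{\pm}(z)$, where $\delta(z)=\sum_{j\in\mathbb{Z}}z^j$ and $g(z)=\frac{q^2z-1}{z-q^2}$ is expanded about $z=0$. A level $k$ integrable module means an integrable highest weight module (with respect to the standard identification of this algebra with the Drinfeld–Jimbo algebra $U_q(\hat{\mathfrak{sl}}(2))$: highest weight dominant integral, Chevalley generators acting locally nilpotently) on which $c$ acts as the scalar $k$. The correlation functions of $x^+(z)x^+(w)$ on $V$ are its matrix coefficients $\langle v^*, x^+(z)x^+(w)v\rangle$, for $v\in V$ and $v^*$ in the restricted (weight-graded) dual of $V$. Each is a formal Laurent series understood as the expansion, in the region $|z|\gg|w|$, of a rational function; poles are those of this rational function at nonzero $z,w$ (so "no poles" means a Laurent polynomial in $z,w$). *)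

theory Defs
  imports
    "HOL-Computational_Algebra.Computational_Algebra"
    "HOL-Algebra.Algebraic_Closure_Type"
begin

section \<open>Ground field and structure function\<close>

text \<open>The field of rational functions over the complex numbers in the variable
  \<open>q_half\<close>, a square root of \<open>q\<close>.\<close>

type_synonym K = "complex poly fract"

definition q_half :: K where
  "q_half = Fract [:0, 1:] 1"

definition q :: K where
  "q = q_half ^ 2"

text \<open>The expansion of \<open>g\<close> about the origin; its constant coefficient is nonzero,
  so \<open>inverse g\<close> is the multiplicative inverse of this power series.\<close>

definition g :: "K fps" where
  "g = (fps_const (q ^ 2) * fps_X - 1) / (fps_X - fps_const (q ^ 2))"


section \<open>Modules over the quantum affine algebra in Drinfeld's current realization\<close>

text \<open>The data of a module on the type \<open>'v\<close>: scalar multiplication and the action of the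
  generators. \<open>Xp M l\<close>, \<open>Xm M l\<close>, \<open>Phi M m\<close>, \<open>Psi M m\<close> are the actions of
  \<open>x\<^sup>+(l)\<close>, \<open>x\<^sup>-(l)\<close>, \<open>\<phi>(m)\<close>, \<open>\<psi>(m)\<close>, where \<open>\<phi>(m)\<close> is extended by zero to \<open>m > 0\<close>
  and \<open>\<psi>(m)\<close> by zero to \<open>m < 0\<close>. \<open>Qc M n\<close> is the action of \<open>q\<^bsup>nc/2\<^esup>\<close>.\<close>

record 'v uq_rep =
  scl :: "K \<Rightarrow> 'v \<Rightarrow> 'v"
  Xp :: "int \<Rightarrow> 'v \<Rightarrow> 'v"
  Xm :: "int \<Rightarrow> 'v \<Rightarrow> 'v"
  Phi :: "int \<Rightarrow> 'v \<Rightarrow> 'v"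
  Psi :: "int \<Rightarrow> 'v \<Rightarrow> 'v"
  Qc :: "int \<Rightarrow> 'v \<Rightarrow> 'v"

text \<open>Each relation between currents is written out by coefficients; a relation
  \<open>A(z) B(w) A(z)\<^sup>-\<^sup>1 = f B(w)\<close> or \<open>A(z) B(w) A(z)\<^sup>-\<^sup>1 B(w)\<^sup>-\<^sup>1 = f\<close> is read with the inverse
  currents moved to the right-hand side. A substitution \<open>g(u q\<^bsup>nc/2\<^esup>)\<close> multiplies the
  coefficient of \<open>u\<^sup>i\<close> by the operator \<open>q\<^bsup>inc/2\<^esup>\<close>.\<close>

locale uq_module = vector_space "scl M"
  for M :: "'v::ab_group_add uq_rep" +
  assumes linear_Xp: "Vector_Spaces.linear (scl M) (scl M) (Xp M l)"
    and linear_Xm: "Vector_Spaces.linear (scl M) (scl M) (Xm M l)"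
    and linear_Phi: "Vector_Spaces.linear (scl M) (scl M) (Phi M l)"
    and linear_Psi: "Vector_Spaces.linear (scl M) (scl M) (Psi M l)"
    and linear_Qc: "Vector_Spaces.linear (scl M) (scl M) (Qc M l)"
    and Phi_pos: "l > 0 \<Longrightarrow> Phi M l v = 0"
    and Psi_neg: "l < 0 \<Longrightarrow> Psi M l v = 0"
    and Qc_0: "Qc M 0 v = v"
    and Qc_add: "Qc M (l + m) v = Qc M l (Qc M m v)"
    and Qc_Xp: "Qc M n (Xp M l v) = Xp M l (Qc M n v)"
    and Qc_Xm: "Qc M n (Xm M l v) = Xm M l (Qc M n v)"
    and Qc_Phi: "Qc M n (Phi M l v) = Phi M l (Qc M n v)"
    and Qc_Psi: "Qc M n (Psi M l v) = Psi M l (Qc M n v)"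
    and Phi_0_Psi_0: "Phi M 0 (Psi M 0 v) = v"
    and Psi_0_Phi_0: "Psi M 0 (Phi M 0 v) = v"
    and Phi_Phi: "Phi M l (Phi M m v) = Phi M m (Phi M l v)"
    and Psi_Psi: "Psi M l (Psi M m v) = Psi M m (Psi M l v)"
    \<comment> \<open>coefficient of \<open>z\<^sup>a w\<^sup>-\<^sup>b\<close>, where \<open>i + j\<close> is the exponent of \<open>z/w\<close>\<close>
    and Phi_Psi: "Phi M (- int a) (Psi M (int b) v) =
      (\<Sum>(i, j) | i + j \<le> min a b.
        scl M (fps_nth g i * fps_nth (inverse g) j)
          (Qc M (2 * int j - 2 * int i)
            (Psi M (int b - int (i + j)) (Phi M (int (i + j) - int a) v))))"
    and Phi_Xp: "Phi M (- int a) (Xp M l v) =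
      (\<Sum>i\<le>a. scl M (fps_nth g i)
        (Qc M (- int i) (Xp M (l - int i) (Phi M (int i - int a) v))))"
    and Phi_Xm: "Phi M (- int a) (Xm M l v) =
      (\<Sum>i\<le>a. scl M (fps_nth (inverse g) i)
        (Qc M (int i) (Xm M (l - int i) (Phi M (int i - int a) v))))"
    and Psi_Xp: "Psi M (int b) (Xp M l v) =
      (\<Sum>i\<le>b. scl M (fps_nth (inverse g) i)
        (Qc M (- int i) (Xp M (l + int i) (Psi M (int b - int i) v))))"
    and Psi_Xm: "Psi M (int b) (Xm M l v) =
      (\<Sum>i\<le>b. scl M (fps_nth g i)
        (Qc M (int i) (Xm M (l + int i) (Psi M (int b - int i) v))))"
    \<comment> \<open>coefficient of \<open>z\<^sup>-\<^sup>l w\<^sup>-\<^sup>m\<close> in the last two relations\<close>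
    and Xp_Xm: "Xp M l (Xm M m v) - Xm M m (Xp M l v) =
      scl M (1 / (q - inverse q))
        (Qc M (l - m) (Psi M (l + m) v) - Qc M (m - l) (Phi M (l + m) v))"
    and Xp_Xp: "Xp M (l + 1) (Xp M m v) - scl M (q ^ 2) (Xp M l (Xp M (m + 1) v)) =
      scl M (q ^ 2) (Xp M m (Xp M (l + 1) v)) - Xp M (m + 1) (Xp M l v)"
    and Xm_Xm: "Xm M (l + 1) (Xm M m v) - scl M (inverse q ^ 2) (Xm M l (Xm M (m + 1) v)) =
      scl M (inverse q ^ 2) (Xm M m (Xm M (l + 1) v)) - Xm M (m + 1) (Xm M l v)"

definition has_level :: "'v uq_rep \<Rightarrow> nat \<Rightarrow> bool" where
  "has_level M k \<longleftrightarrow> (\<forall>n v. Qc M n v = scl M (power_int q_half (n * int k)) v)"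


section \<open>Chevalley generators and integrable highest weight modules\<close>

text \<open>The standard identification with the Drinfeld--Jimbo generators:
  \<open>K\<^sub>1 = \<psi>(0)\<close>, \<open>K\<^sub>0 = q\<^bsup>c\<^esup> K\<^sub>1\<^sup>-\<^sup>1\<close>, \<open>e\<^sub>1 = x\<^sup>+(0)\<close>, \<open>f\<^sub>1 = x\<^sup>-(0)\<close>, \<open>e\<^sub>0 = x\<^sup>-(1) K\<^sub>1\<^sup>-\<^sup>1\<close>,
  \<open>f\<^sub>0 = K\<^sub>1 x\<^sup>+(-1)\<close>, where \<open>K\<^sub>1\<^sup>-\<^sup>1 = \<phi>(0)\<close>.\<close>

definition chev_K0 :: "'v uq_rep \<Rightarrow> 'v \<Rightarrow> 'v" where
  "chev_K0 M v = Qc M 2 (Phi M 0 v)"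

definition chev_K1 :: "'v uq_rep \<Rightarrow> 'v \<Rightarrow> 'v" where
  "chev_K1 M v = Psi M 0 v"

definition chev_e0 :: "'v uq_rep \<Rightarrow> 'v \<Rightarrow> 'v" where
  "chev_e0 M v = Xm M 1 (Phi M 0 v)"

definition chev_e1 :: "'v uq_rep \<Rightarrow> 'v \<Rightarrow> 'v" where
  "chev_e1 M v = Xp M 0 v"

definition chev_f0 :: "'v uq_rep \<Rightarrow> 'v \<Rightarrow> 'v" where
  "chev_f0 M v = Psi M 0 (Xp M (- 1) v)"

definition chev_f1 :: "'v uq_rep \<Rightarrow> 'v \<Rightarrow> 'v" where
  "chev_f1 M v = Xm M 0 v"

definition locally_nilpotent :: "('v::zero \<Rightarrow> 'v) \<Rightarrow> bool" where
  "locally_nilpotent T \<longleftrightarrow> (\<forall>v. \<exists>n. (T ^^ n) v = 0)"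

definition submodule :: "'v::ab_group_add uq_rep \<Rightarrow> 'v set \<Rightarrow> bool" where
  "submodule M S \<longleftrightarrow> module.subspace (scl M) S \<and>
    (\<forall>l. \<forall>u\<in>S. Xp M l u \<in> S \<and> Xm M l u \<in> S \<and> Phi M l u \<in> S \<and> Psi M l u \<in> S \<and> Qc M l u \<in> S)"

definition highest_weight_module ::
    "'v::ab_group_add uq_rep \<Rightarrow> 'v \<Rightarrow> nat \<Rightarrow> nat \<Rightarrow> bool" where
  "highest_weight_module M v0 n0 n1 \<longleftrightarrow>
    v0 \<noteq> 0 \<and> chev_e0 M v0 = 0 \<and> chev_e1 M v0 = 0 \<and>
    chev_K0 M v0 = scl M (q ^ n0) v0 \<and> chev_K1 M v0 = scl M (q ^ n1) v0 \<and>
    (\<forall>S. submodule M S \<and> v0 \<in> S \<longrightarrow> S = UNIV)"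

text \<open>\<open>v0\<close> is a highest weight vector. Its weight is dominant integral because \<open>n0\<close>, \<open>n1\<close>
  are natural numbers.\<close>

definition integrable_highest_weight_module ::
    "'v::ab_group_add uq_rep \<Rightarrow> 'v \<Rightarrow> bool" where
  "integrable_highest_weight_module M v0 \<longleftrightarrow>
    (\<exists>n0 n1. highest_weight_module M v0 n0 n1) \<and>
    locally_nilpotent (chev_e0 M) \<and> locally_nilpotent (chev_e1 M) \<and>
    locally_nilpotent (chev_f0 M) \<and> locally_nilpotent (chev_f1 M)"


section \<open>Restricted dual and correlation functions\<close>

text \<open>The algebra contains no degree operator, so \<open>K\<^sub>0\<close> and \<open>K\<^sub>1\<close> do not separate the affine
  weights. The space of weight \<open>\<lambda> - a \<alpha>\<^sub>0 - b \<alpha>\<^sub>1\<close> is spanned by the monomials in \<open>f\<^sub>0\<close>, \<open>f\<^sub>1\<close>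
  containing \<open>f\<^sub>0\<close> exactly \<open>a\<close> times and \<open>f\<^sub>1\<close> exactly \<open>b\<close> times, applied to \<open>v0\<close>.\<close>

inductive_set f_monomials :: "'v uq_rep \<Rightarrow> 'v \<Rightarrow> (nat \<times> nat \<times> 'v) set"
  for M :: "'v uq_rep" and v0 :: 'v where
  base: "(0, 0, v0) \<in> f_monomials M v0"
| step0: "(a, b, u) \<in> f_monomials M v0 \<Longrightarrow> (Suc a, b, chev_f0 M u) \<in> f_monomials M v0"
| step1: "(a, b, u) \<in> f_monomials M v0 \<Longrightarrow> (a, Suc b, chev_f1 M u) \<in> f_monomials M v0"

definition weight_space ::
    "'v::ab_group_add uq_rep \<Rightarrow> 'v \<Rightarrow> nat \<Rightarrow> nat \<Rightarrow> 'v set" where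
  "weight_space M v0 a b = module.span (scl M) {u. (a, b, u) \<in> f_monomials M v0}"

definition restricted_dual ::
    "'v::ab_group_add uq_rep \<Rightarrow> 'v \<Rightarrow> ('v \<Rightarrow> K) set" where
  "restricted_dual M v0 = {\<xi>. Vector_Spaces.linear (scl M) (*) \<xi> \<and>
    finite {(a, b). \<exists>u \<in> weight_space M v0 a b. \<xi> u \<noteq> 0}}"

text \<open>The coefficient of \<open>z\<^sup>-\<^sup>l w\<^sup>-\<^sup>m\<close> in \<open>\<langle>\<xi>, x\<^sup>+(z) x\<^sup>+(w) v\<rangle>\<close>.\<close>

definition correlation :: "'v uq_rep \<Rightarrow> ('v \<Rightarrow> K) \<Rightarrow> 'v \<Rightarrow> int \<Rightarrow> int \<Rightarrow> K" where
  "correlation M \<xi> v l m = \<xi> (Xp M l (Xp M m v))"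


section \<open>Rational functions in two variables\<close>

text \<open>In \<open>K poly poly\<close> the inner variable is \<open>z\<close> and the outer variable is \<open>w\<close>.\<close>

definition laurent_of_poly2 :: "K poly poly \<Rightarrow> K fls fls" where
  "laurent_of_poly2 p =
    fps_to_fls (fps_of_poly (map_poly (\<lambda>c. fps_to_fls (fps_of_poly c)) p))"

text \<open>The expansion of \<open>A/B\<close> for \<open>|z|\<close> much larger than \<open>|w|\<close> is the quotient in the field of
  iterated Laurent series \<open>K((z))((w))\<close>; for instance \<open>1/(z - c w)\<close> becomes
  \<open>\<Sum>n. c\<^sup>n w\<^sup>n z\<^bsup>-n-1\<^esup>\<close>. The family \<open>F\<close> lists the coefficients of the monomials
  \<open>z\<^sup>-\<^sup>l w\<^sup>-\<^sup>m\<close>, the convention used for currents.\<close>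

definition is_expansion_of :: "(int \<Rightarrow> int \<Rightarrow> K) \<Rightarrow> K poly poly fract \<Rightarrow> bool" where
  "is_expansion_of F R \<longleftrightarrow> (\<exists>A B. B \<noteq> 0 \<and> R = Fract A B \<and>
    (\<forall>l m. F l m = fls_nth (fls_nth (laurent_of_poly2 A / laurent_of_poly2 B) (- m)) (- l)))"

definition eval_poly2 :: "K poly poly \<Rightarrow> K alg_closure \<Rightarrow> K alg_closure \<Rightarrow> K alg_closure" where
  "eval_poly2 p z w = poly (map_poly (\<lambda>c. poly (map_poly to_ac c) z) p) w"

text \<open>Poles are points over the algebraic closure: the curve defined by a denominator can have
  too few \<open>K\<close>-rational points to be seen over \<open>K\<close>.\<close>

definition is_pole_at :: "K poly poly fract \<Rightarrow> K alg_closure \<Rightarrow> K alg_closure \<Rightarrow> bool" where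
  "is_pole_at R z w \<longleftrightarrow> \<not> (\<exists>A B. R = Fract A B \<and> eval_poly2 B z w \<noteq> 0)"

end

theory Submission
  imports Defs
begin

text \<open>Write \<open>F(z, w)\<close> for a correlation function of \<open>x\<^sup>+(z) x\<^sup>+(w)\<close>. The quadratic relation for
  \<open>x\<^sup>+\<close> says that \<open>(z - q\<^sup>2 w) F(z, w)\<close> is antisymmetric in \<open>z\<close> and \<open>w\<close>. Since \<open>x\<^sup>+(l)\<close> shifts
  the weight by \<open>\<alpha>\<^sub>1 + l \<delta>\<close>, the coefficient of \<open>z\<^sup>-\<^sup>l w\<^sup>-\<^sup>m\<close> vanishes when \<open>m\<close> or
  \<open>\<bar>l + m\<bar>\<close> is large; antisymmetry then also bounds \<open>l\<close> from above, so that
  \<open>(z - q\<^sup>2 w) F(z, w)\<close> is a Laurent polynomial. The weight shifts follow from those of the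
  Chevalley generators, because commutators with \<open>\<psi>(1)\<close> and \<open>\<phi>(-1)\<close>, themselves commutators of
  Chevalley generators up to scalars, raise and lower the index of \<open>x\<^sup>\<plusminus>(l)\<close>.\<close>

section \<open>Structure constants\<close>

lemma q_half_eq: "q_half = to_fract [:0, 1:]"
  by (simp add: q_half_def to_fract_def)

lemma to_fract_power: "to_fract (x ^ n) = to_fract x ^ n"
  by (induction n) simp_all

lemma q_half_nonzero: "q_half \<noteq> 0"
  by (simp add: q_half_eq)

lemma q_nonzero: "q \<noteq> 0"
  by (simp add: q_def q_half_nonzero)

text \<open>A positive power of the indeterminate vanishes at the origin, while \<open>1\<close>
  does not. This makes the later divisors \<open>q - inverse q\<close> and \<open>q ^ 4 - 1\<close>
  nonzero.\<close>

lemma q_power_neq_1: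
  assumes "n > 0"
  shows "q ^ n \<noteq> 1"
proof
  assume "q ^ n = 1"
  then have "to_fract ([:0, 1:] ^ (2 * n)) = (to_fract 1 :: K)"
    by (simp add: q_def q_half_eq power_mult to_fract_power)
  then have "poly ([:0, 1:] ^ (2 * n)) (0 :: complex) = poly 1 0"
    by (simp only: to_fract_eq_iff)
  then show False
    using assms by (simp add: poly_power power_0_left)
qed

lemma q_minus_inverse_nonzero: "q - inverse q \<noteq> 0"
  using q_power_neq_1[of 2] q_nonzero by (auto simp: field_simps power2_eq_square)

lemma two_nonzero: "(2 :: K) \<noteq> 0"
proof -
  have "(2 :: K) = to_fract (1 + 1)"
    by (subst to_fract_add) simp
  then show ?thesis
    by (simp only: to_fract_eq_0_iff) simp
qed

text \<open>Two coefficients suffice, since the relations of \<phi> and \<psi> with the other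
  currents are applied only in modes 0, 1 and -1. They come from comparing coefficients after
  clearing the denominator.\<close>

lemma fps_nth_g:
  "fps_nth g 0 = inverse q ^ 2"
  "fps_nth g 1 = inverse q ^ 4 - 1"
proof -
  let ?d = "fps_X - fps_const (q ^ 2)"
  have unit: "fps_nth ?d 0 \<noteq> 0"
    using q_nonzero by simp
  then have "subdegree ?d = 0" "?d \<noteq> 0"
    using subdegree_eq_0_iff by auto
  then have eq: "g * ?d = fps_const (q ^ 2) * fps_X - 1"
    unfolding g_def by (intro fps_times_divide_eq) simp_all
  from arg_cong[OF eq, of "\<lambda>f. fps_nth f 0"] show 0: "fps_nth g 0 = inverse q ^ 2"
    using q_nonzero by (simp add: field_simps)
  from arg_cong[OF eq, of "\<lambda>f. fps_nth f 1"] show "fps_nth g 1 = inverse q ^ 4 - 1"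
    using q_nonzero 0 by (simp add: fps_mult_nth_1 field_simps)
qed

lemma fps_nth_inverse_g:
  "fps_nth (inverse g) 0 = q ^ 2"
  "fps_nth (inverse g) 1 = q ^ 4 - 1"
proof -
  have "fps_nth g 0 \<noteq> 0"
    using q_nonzero by (simp add: fps_nth_g)
  then have eq: "g * inverse g = 1"
    by (rule inverse_mult_eq_1')
  show 0: "fps_nth (inverse g) 0 = q ^ 2"
    by (simp add: fps_nth_g field_simps)
  from arg_cong[OF eq, of "\<lambda>f. fps_nth f 1"]
  have "inverse q ^ 2 * fps_nth (inverse g) 1 = - ((inverse q ^ 4 - 1) * q ^ 2)"
    using fps_nth_g 0 by (simp add: fps_mult_nth_1 eq_neg_iff_add_eq_0 del: fps_inverse_nth_0)
  then have "q ^ 2 * (inverse q ^ 2 * fps_nth (inverse g) 1) = - (q ^ 2 * (inverse q ^ 4 - 1) * q ^ 2)"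
    by simp
  then show "fps_nth (inverse g) 1 = q ^ 4 - 1"
    using q_nonzero by (simp add: power_inverse algebra_simps flip: power_add)
qed

lemma linear_simps:
  assumes "Vector_Spaces.linear s1 s2 f"
  shows "f (u + v) = f u + f v" "f (u - v) = f u - f v" "f (s1 c u) = s2 c (f u)" "f 0 = 0"
proof -
  interpret Vector_Spaces.linear s1 s2 f by fact
  show "f (u + v) = f u + f v" "f (u - v) = f u - f v" "f (s1 c u) = s2 c (f u)" "f 0 = 0"
    by (simp_all add: add diff scale zero)
qed

section \<open>Action of the Drinfeld generators on weight spaces\<close>

locale uq_level_module = uq_module M for M :: "'v::ab_group_add uq_rep" +
  fixes k :: nat
  assumes level: "has_level M k"
begin

lemmas Xp_linear = linear_simps[OF linear_Xp]
  and Xm_linear = linear_simps[OF linear_Xm]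
  and Phi_linear = linear_simps[OF linear_Phi]
  and Psi_linear = linear_simps[OF linear_Psi]

lemmas op_linear = Xp_linear Xm_linear Phi_linear Psi_linear

definition qc :: "int \<Rightarrow> K" where
  "qc n = power_int q_half (n * int k)"

lemma Qc_eq: "Qc M n v = scl M (qc n) v"
  using level by (simp add: has_level_def qc_def)

lemma qc_nonzero: "qc n \<noteq> 0"
  by (simp add: qc_def q_half_nonzero)

lemma qc_0: "qc 0 = 1"
  by (simp add: qc_def)

section \<open>Relations in modes 0, 1 and -1\<close>

lemma K_commute:
  "Psi M 0 (Xp M l v) = scl M (q ^ 2) (Xp M l (Psi M 0 v))"
  "Phi M 0 (Xp M l v) = scl M (inverse q ^ 2) (Xp M l (Phi M 0 v))"
  "Psi M 0 (Xm M l v) = scl M (inverse q ^ 2) (Xm M l (Psi M 0 v))"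
  "Phi M 0 (Xm M l v) = scl M (q ^ 2) (Xm M l (Phi M 0 v))"
  using Psi_Xp[of 0 l v] Phi_Xp[of 0 l v] Psi_Xm[of 0 l v] Phi_Xm[of 0 l v]
  by (simp_all add: fps_nth_g fps_nth_inverse_g Qc_0 del: fps_inverse_nth_0)

lemma scl_solve: "scl M c u = v \<Longrightarrow> c \<noteq> 0 \<Longrightarrow> u = scl M (inverse c) v"
  by auto

lemma double_cancel:
  fixes u v :: 'v
  assumes "u + u = v + v"
  shows "u = v"
proof -
  have "scl M 2 u = scl M 2 v"
    using assms scale_left_distrib[of 1 1] by (simp add: one_add_one)
  then show ?thesis
    by (simp add: scale_cancel_left two_nonzero)
qed

text \<open>The mode 1 relation between \<psi> and \<open>x\<^sup>+\<close> has one term with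
  \<open>\<psi>(1)\<close> and one with \<open>x\<^sup>+(l + 1) \<psi>(0)\<close> on its right-hand
  side. Applied to \<open>Phi M 0 v\<close> it loses \<open>\<psi>(0)\<close>, and the fixed level
  turns the central factor into a nonzero scalar, so \<open>x\<^sup>+(l + 1)\<close> can be solved
  for. The next three lemmas treat lowering by \<open>\<phi>(-1)\<close> and the modes of
  \<open>x\<^sup>-\<close> in the same way.\<close>

lemma Xp_succ:
  "Xp M (l + 1) v = scl M (inverse ((q ^ 4 - 1) * qc (- 1)))
    (Psi M 1 (Xp M l (Phi M 0 v)) - scl M (q ^ 2) (Xp M l (Psi M 1 (Phi M 0 v))))"
proof -
  have "scl M ((q ^ 4 - 1) * qc (- 1)) (Xp M (l + 1) v) =
    Psi M 1 (Xp M l (Phi M 0 v)) - scl M (q ^ 2) (Xp M l (Psi M 1 (Phi M 0 v)))"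
    using Psi_Xp[of 1 l "Phi M 0 v"] fps_nth_inverse_g
    by (simp add: Qc_eq qc_0 Psi_0_Phi_0 del: fps_inverse_nth_0)
  moreover have "(q ^ 4 - 1) * qc (- 1) \<noteq> 0"
    using q_power_neq_1[of 4] qc_nonzero by simp
  ultimately show ?thesis
    by (rule scl_solve)
qed

lemma Xp_pred:
  "Xp M (l - 1) v = scl M (inverse ((inverse q ^ 4 - 1) * qc (- 1)))
    (Phi M (- 1) (Xp M l (Psi M 0 v)) - scl M (inverse q ^ 2) (Xp M l (Phi M (- 1) (Psi M 0 v))))"
proof -
  have "scl M ((inverse q ^ 4 - 1) * qc (- 1)) (Xp M (l - 1) v) =
    Phi M (- 1) (Xp M l (Psi M 0 v)) - scl M (inverse q ^ 2) (Xp M l (Phi M (- 1) (Psi M 0 v)))"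
    using Phi_Xp[of 1 l "Psi M 0 v"] fps_nth_g
    by (simp add: Qc_eq qc_0 Phi_0_Psi_0)
  moreover have "(inverse q ^ 4 - 1) * qc (- 1) \<noteq> 0"
    using q_power_neq_1[of 4] qc_nonzero q_nonzero by (simp add: power_inverse)
  ultimately show ?thesis
    by (rule scl_solve)
qed

lemma Xm_succ:
  "Xm M (l + 1) v = scl M (inverse ((inverse q ^ 4 - 1) * qc 1))
    (Psi M 1 (Xm M l (Phi M 0 v)) - scl M (inverse q ^ 2) (Xm M l (Psi M 1 (Phi M 0 v))))"
proof -
  have "scl M ((inverse q ^ 4 - 1) * qc 1) (Xm M (l + 1) v) =
    Psi M 1 (Xm M l (Phi M 0 v)) - scl M (inverse q ^ 2) (Xm M l (Psi M 1 (Phi M 0 v)))"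
    using Psi_Xm[of 1 l "Phi M 0 v"] fps_nth_g
    by (simp add: Qc_eq qc_0 Psi_0_Phi_0)
  moreover have "(inverse q ^ 4 - 1) * qc 1 \<noteq> 0"
    using q_power_neq_1[of 4] qc_nonzero q_nonzero by (simp add: power_inverse)
  ultimately show ?thesis
    by (rule scl_solve)
qed

lemma Xm_pred:
  "Xm M (l - 1) v = scl M (inverse ((q ^ 4 - 1) * qc 1))
    (Phi M (- 1) (Xm M l (Psi M 0 v)) - scl M (q ^ 2) (Xm M l (Phi M (- 1) (Psi M 0 v))))"
proof -
  have "scl M ((q ^ 4 - 1) * qc 1) (Xm M (l - 1) v) =
    Phi M (- 1) (Xm M l (Psi M 0 v)) - scl M (q ^ 2) (Xm M l (Phi M (- 1) (Psi M 0 v)))"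
    using Phi_Xm[of 1 l "Psi M 0 v"] fps_nth_inverse_g
    by (simp add: Qc_eq qc_0 Phi_0_Psi_0 del: fps_inverse_nth_0)
  moreover have "(q ^ 4 - 1) * qc 1 \<noteq> 0"
    using q_power_neq_1[of 4] qc_nonzero by simp
  ultimately show ?thesis
    by (rule scl_solve)
qed

text \<open>For a positive total mode the \<phi> term of the commutator vanishes, which isolates
  \<psi>; for a negative one the roles are exchanged.\<close>

lemma Psi_eq_commutator:
  assumes "l + m > 0"
  shows "Psi M (l + m) v =
    scl M (inverse (1 / (q - inverse q) * qc (l - m))) (Xp M l (Xm M m v) - Xm M m (Xp M l v))"
proof -
  have "scl M (1 / (q - inverse q) * qc (l - m)) (Psi M (l + m) v) =
      Xp M l (Xm M m v) - Xm M m (Xp M l v)"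
    using assms by (simp add: Xp_Xm Phi_pos Qc_eq)
  moreover have "1 / (q - inverse q) * qc (l - m) \<noteq> 0"
    using q_minus_inverse_nonzero qc_nonzero by simp
  ultimately show ?thesis
    by (rule scl_solve)
qed

lemma Phi_eq_commutator:
  assumes "l + m < 0"
  shows "Phi M (l + m) v =
    scl M (inverse (1 / (q - inverse q) * - qc (m - l))) (Xp M l (Xm M m v) - Xm M m (Xp M l v))"
proof -
  have "scl M (1 / (q - inverse q) * - qc (m - l)) (Phi M (l + m) v) =
      Xp M l (Xm M m v) - Xm M m (Xp M l v)"
    using assms by (simp add: Xp_Xm Psi_neg Qc_eq)
  moreover have "1 / (q - inverse q) * - qc (m - l) \<noteq> 0"
    using q_minus_inverse_nonzero qc_nonzero by simp
  ultimately show ?thesis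
    by (rule scl_solve)
qed

text \<open>With both indices equal to -1 the two sides of the quadratic relation are negatives of
  each other, so it is twice the wanted identity; \<open>double_cancel\<close> removes the factor.
  The next lemma does this with both indices equal to 0.\<close>

lemma Xp_0_Xp_minus_1: "Xp M 0 (Xp M (- 1) v) = scl M (q ^ 2) (Xp M (- 1) (Xp M 0 v))"
  using Xp_Xp[of "- 1" "- 1" v] by - (rule double_cancel, simp add: algebra_simps)

lemma Xm_1_Xm_0: "Xm M 1 (Xm M 0 v) = scl M (inverse q ^ 2) (Xm M 0 (Xm M 1 v))"
  using Xm_Xm[of 0 0 v] by - (rule double_cancel, simp add: algebra_simps)

end

section \<open>Weight spaces of a highest weight module\<close>

locale uq_highest_weight_module = uq_level_module M k
  for M :: "'v::ab_group_add uq_rep" and k +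
  fixes v0 :: 'v and n0 n1 :: nat
  assumes highest_weight: "highest_weight_module M v0 n0 n1"
begin

text \<open>Integer indices allow raising operators to subtract freely. The zero space outside the
  quadrant says that no weight lies outside the cone below the highest weight.\<close>

definition wt :: "int \<Rightarrow> int \<Rightarrow> 'v set" where
  "wt a b = (if a \<ge> 0 \<and> b \<ge> 0 then weight_space M v0 (nat a) (nat b) else {0})"

lemma subspace_wt: "subspace (wt a b)"
  by (simp add: wt_def weight_space_def subspace_single_0)

lemmas wt_closed =
  subspace_wt[THEN subspace_0] subspace_wt[THEN subspace_add]
  subspace_wt[THEN subspace_diff] subspace_wt[THEN subspace_scale]

lemma f_monomial_in_wt: "(a, b, u) \<in> f_monomials M v0 \<Longrightarrow> u \<in> wt (int a) (int b)"
  by (simp add: wt_def weight_space_def span_base)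

text \<open>Indices count lowering steps, so these are the operators of weight
  \<open>- i \<alpha>\<^sub>0 - j \<alpha>\<^sub>1\<close>.\<close>

definition shifts_wt :: "('v \<Rightarrow> 'v) \<Rightarrow> int \<Rightarrow> int \<Rightarrow> bool" where
  "shifts_wt T i j \<longleftrightarrow> (\<forall>a b. \<forall>u \<in> wt a b. T u \<in> wt (a + i) (b + j))"

lemma shifts_wtD: "shifts_wt T i j \<Longrightarrow> u \<in> wt a b \<Longrightarrow> a + i = a' \<Longrightarrow> b + j = b' \<Longrightarrow> T u \<in> wt a' b'"
  by (auto simp: shifts_wt_def)

lemma shifts_wt_from_monomials:
  assumes T: "Vector_Spaces.linear (scl M) (scl M) T"
    and mono: "\<And>a b u. (a, b, u) \<in> f_monomials M v0 \<Longrightarrow> T u \<in> wt (int a + i) (int b + j)"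
  shows "shifts_wt T i j"
  unfolding shifts_wt_def
proof (intro allI ballI)
  fix a b u
  assume u: "u \<in> wt a b"
  show "T u \<in> wt (a + i) (b + j)"
  proof (cases "a \<ge> 0 \<and> b \<ge> 0")
    case True
    with u have "u \<in> span {u. (nat a, nat b, u) \<in> f_monomials M v0}"
      by (simp add: wt_def weight_space_def)
    then show ?thesis
    proof (induction rule: span_induct)
      show "subspace {u. T u \<in> wt (a + i) (b + j)}"
        by (intro subspaceI) (auto simp: linear_simps[OF T] wt_closed)
    next
      fix u
      assume "u \<in> {u. (nat a, nat b, u) \<in> f_monomials M v0}"
      then show "T u \<in> wt (a + i) (b + j)"
        using mono[of "nat a" "nat b" u] True by simp
    qed
  next
    case False
    with u have "u = 0"
      by (auto simp: wt_def)
    then show ?thesis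
      by (simp add: linear_simps[OF T] wt_closed)
  qed
qed

lemma v0_facts:
  "Xp M 0 v0 = 0" "Xm M 1 v0 = 0"
  "Psi M 0 v0 = scl M (q ^ n1) v0" "Phi M 0 v0 = scl M (inverse q ^ n1) v0"
proof -
  show "Xp M 0 v0 = 0" and K: "Psi M 0 v0 = scl M (q ^ n1) v0"
    using highest_weight
    by (simp_all add: highest_weight_module_def chev_e1_def chev_K1_def)
  \<comment> \<open>The eigenvalue of \<open>Phi M 0\<close> is found first because it strips the
    factor \<open>K\<^sub>1\<^sup>-\<^sup>1\<close> from the condition
    \<open>chev_e0 M v0 = 0\<close>.\<close>
  have "v0 = scl M (q ^ n1) (Phi M 0 v0)"
    using Phi_0_Psi_0[of v0] K by (simp add: op_linear)
  then show K': "Phi M 0 v0 = scl M (inverse q ^ n1) v0"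
    using q_nonzero scl_solve[of "q ^ n1" "Phi M 0 v0" v0] by (simp add: power_inverse)
  have "Xm M 1 (Phi M 0 v0) = 0"
    using highest_weight by (simp add: highest_weight_module_def chev_e0_def)
  then show "Xm M 1 v0 = 0"
    using q_nonzero by (simp add: K' op_linear)
qed

text \<open>Moving \<open>K\<^sub>1\<close> past \<open>f\<^sub>0\<close> or
  \<open>f\<^sub>1\<close> costs only a power of \<open>q\<close>, so monomials remain eigenvectors.
  Existence of an eigenvalue is enough to preserve weight spaces.\<close>

lemma K_monomial:
  assumes "(a, b, u) \<in> f_monomials M v0"
  shows "(\<exists>c. Psi M 0 u = scl M c u) \<and> (\<exists>c. Phi M 0 u = scl M c u)"
  using assms
proof induction
  case base
  show ?case
    using v0_facts by blast
next
  case (step0 a b u)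
  then obtain c d where "Psi M 0 u = scl M c u" "Phi M 0 u = scl M d u"
    by blast
  then have "Psi M 0 (chev_f0 M u) = scl M (q ^ 2 * c) (chev_f0 M u)"
      "Phi M 0 (chev_f0 M u) = scl M (inverse q ^ 2 * d) (chev_f0 M u)"
    by (simp_all add: chev_f0_def op_linear K_commute)
  then show ?case
    by blast
next
  case (step1 a b u)
  then obtain c d where "Psi M 0 u = scl M c u" "Phi M 0 u = scl M d u"
    by blast
  then have "Psi M 0 (chev_f1 M u) = scl M (inverse q ^ 2 * c) (chev_f1 M u)"
      "Phi M 0 (chev_f1 M u) = scl M (q ^ 2 * d) (chev_f1 M u)"
    by (simp_all add: chev_f1_def op_linear K_commute)
  then show ?case
    by blast
qed

section \<open>Weights of the Chevalley generators\<close>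

lemma shifts_Psi_0: "shifts_wt (Psi M 0) 0 0"
proof (rule shifts_wt_from_monomials[OF linear_Psi])
  fix a b u assume "(a, b, u) \<in> f_monomials M v0"
  then show "Psi M 0 u \<in> wt (int a + 0) (int b + 0)"
    using K_monomial[of a b u] f_monomial_in_wt[of a b u] by (auto simp: wt_closed)
qed

lemma shifts_Phi_0: "shifts_wt (Phi M 0) 0 0"
proof (rule shifts_wt_from_monomials[OF linear_Phi])
  fix a b u assume "(a, b, u) \<in> f_monomials M v0"
  then show "Phi M 0 u \<in> wt (int a + 0) (int b + 0)"
    using K_monomial[of a b u] f_monomial_in_wt[of a b u] by (auto simp: wt_closed)
qed

lemma shifts_Xm_0: "shifts_wt (Xm M 0) 0 1"
proof (rule shifts_wt_from_monomials[OF linear_Xm])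
  fix a b u assume "(a, b, u) \<in> f_monomials M v0"
  from f_monomial_in_wt[OF f_monomials.step1[OF this]]
  show "Xm M 0 u \<in> wt (int a + 0) (int b + 1)"
    by (simp add: chev_f1_def add.commute)
qed

lemma shifts_Xp_minus_1: "shifts_wt (Xp M (- 1)) 1 0"
proof (rule shifts_wt_from_monomials[OF linear_Xp])
  fix a b u assume "(a, b, u) \<in> f_monomials M v0"
  from f_monomial_in_wt[OF f_monomials.step0[OF this]]
  \<comment> \<open>As \<open>f\<^sub>0 = \<psi>(0) x\<^sup>+(-1)\<close>, applying
    \<open>\<phi>(0)\<close> recovers \<open>x\<^sup>+(-1)\<close>.\<close>
  have "Phi M 0 (chev_f0 M u) \<in> wt (int a + 1) (int b)"
    by (intro shifts_wtD[OF shifts_Phi_0]) (auto simp: add.commute)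
  then show "Xp M (- 1) u \<in> wt (int a + 1) (int b + 0)"
    by (simp add: chev_f0_def Phi_0_Psi_0)
qed

text \<open>Induction along the monomial: \<open>e\<^sub>1\<close> kills \<open>v0\<close> and
  commutes with \<open>f\<^sub>0\<close>, and its commutator with \<open>f\<^sub>1\<close> is a
  combination of \<open>K\<^sub>1\<close> and its inverse, which preserve weight spaces.\<close>

lemma shifts_Xp_0: "shifts_wt (Xp M 0) 0 (- 1)"
proof (rule shifts_wt_from_monomials[OF linear_Xp])
  fix a b u assume "(a, b, u) \<in> f_monomials M v0"
  then show "Xp M 0 u \<in> wt (int a + 0) (int b + - 1)"
  proof induction
    case base
    show ?case by (simp add: v0_facts wt_closed)
  next
    case (step0 a b u)
    have "Xp M 0 (Psi M 0 w) = scl M (inverse q ^ 2) (Psi M 0 (Xp M 0 w))" for w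
      using q_nonzero by (simp add: K_commute power_inverse)
    \<comment> \<open>The factor \<open>q\<^sup>-\<^sup>2\<close> from passing
      \<open>\<psi>(0)\<close> cancels the \<open>q\<^sup>2\<close> of the quadratic
      relation.\<close>
    then have "Xp M 0 (chev_f0 M u) = Psi M 0 (Xp M (- 1) (Xp M 0 u))"
      using q_nonzero by (simp add: chev_f0_def Xp_0_Xp_minus_1 Psi_linear power_inverse)
    moreover have "Psi M 0 (Xp M (- 1) (Xp M 0 u)) \<in> wt (int (Suc a) + 0) (int b + - 1)"
      by (rule shifts_wtD[OF shifts_Psi_0] shifts_wtD[OF shifts_Xp_minus_1] step0.IH)+ auto
    ultimately show ?case by simp
  next
    case (step1 a b u)
    have "Xp M 0 (chev_f1 M u) = Xm M 0 (Xp M 0 u) +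
        scl M (1 / (q - inverse q)) (Psi M 0 u - Phi M 0 u)"
      using Xp_Xm[of 0 0 u] by (simp add: chev_f1_def Qc_0 algebra_simps)
    moreover have "Xm M 0 (Xp M 0 u) \<in> wt (int a) (int b)"
      by (rule shifts_wtD[OF shifts_Xm_0] step1.IH)+ auto
    moreover have "Psi M 0 u \<in> wt (int a) (int b)" "Phi M 0 u \<in> wt (int a) (int b)"
      using f_monomial_in_wt[OF step1.hyps]
      by (auto intro: shifts_wtD[OF shifts_Psi_0] shifts_wtD[OF shifts_Phi_0])
    ultimately show ?case by (simp add: wt_closed)
  qed
qed

text \<open>This is \<open>e\<^sub>0 K\<^sub>1\<close>, so the roles of \<open>f\<^sub>0\<close> and
  \<open>f\<^sub>1\<close> are exchanged: the commutator with \<open>x\<^sup>+(-1)\<close> has total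
  mode 0 and gives \<open>\<psi>(0)\<close> and \<open>\<phi>(0)\<close>, while
  \<open>x\<^sup>-(0)\<close> commutes up to a power of \<open>q\<close>.\<close>

lemma shifts_Xm_1: "shifts_wt (Xm M 1) (- 1) 0"
proof (rule shifts_wt_from_monomials[OF linear_Xm])
  fix a b u assume "(a, b, u) \<in> f_monomials M v0"
  then show "Xm M 1 u \<in> wt (int a + - 1) (int b + 0)"
  proof induction
    case base
    show ?case by (simp add: v0_facts wt_closed)
  next
    case (step0 a b u)
    have 1: "Xm M 1 (Psi M 0 w) = scl M (q ^ 2) (Psi M 0 (Xm M 1 w))" for w
      using q_nonzero by (simp add: K_commute power_inverse)
    have "Xm M 1 (Xp M (- 1) u) = Xp M (- 1) (Xm M 1 u) -
        scl M (1 / (q - inverse q)) (scl M (qc (- 2)) (Psi M 0 u) - scl M (qc 2) (Phi M 0 u))"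
      using Xp_Xm[of "- 1" 1 u] by (simp add: Qc_eq algebra_simps)
    moreover have "Xp M (- 1) (Xm M 1 u) \<in> wt (int a) (int b)"
      by (rule shifts_wtD[OF shifts_Xp_minus_1] step0.IH)+ auto
    moreover have "Psi M 0 u \<in> wt (int a) (int b)" "Phi M 0 u \<in> wt (int a) (int b)"
      using f_monomial_in_wt[OF step0.hyps]
      by (auto intro: shifts_wtD[OF shifts_Psi_0] shifts_wtD[OF shifts_Phi_0])
    ultimately have "Xm M 1 (Xp M (- 1) u) \<in> wt (int a) (int b)"
      by (simp add: wt_closed)
    then have "Psi M 0 (Xm M 1 (Xp M (- 1) u)) \<in> wt (int a) (int b)"
      by (rule shifts_wtD[OF shifts_Psi_0]) auto
    then show ?case
      by (simp add: chev_f0_def 1 wt_closed)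
  next
    case (step1 a b u)
    have "Xm M 0 (Xm M 1 u) \<in> wt (int a + - 1) (int (Suc b) + 0)"
      by (rule shifts_wtD[OF shifts_Xm_0] step1.IH)+ auto
    then show ?case
      by (simp add: chev_f1_def Xm_1_Xm_0 wt_closed)
  qed
qed

section \<open>Weights of all modes\<close>

text \<open>One form for two uses: with \<open>C\<close> equal to \<open>\<phi>(0)\<close> or
  \<open>\<psi>(0)\<close> it fits the mode-shifting formulas, and with \<open>C\<close> the
  identity and \<open>d = 1\<close> it fits ordinary commutators.\<close>

lemma shifts_wt_commutator:
  assumes A: "shifts_wt A i j" and B: "shifts_wt B i' j'" and C: "shifts_wt C 0 0"
    and eq: "\<And>v. P v = scl M c (A (B (C v)) - scl M d (B (A (C v))))"
    and "i + i' = i''" "j + j' = j''"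
  shows "shifts_wt P i'' j''"
  unfolding shifts_wt_def
proof (intro allI ballI)
  fix a b v
  assume "v \<in> wt a b"
  then have v: "C v \<in> wt a b"
    by (rule shifts_wtD[OF C]) simp_all
  have "A (B (C v)) \<in> wt (a + i'') (b + j'')"
    by (rule shifts_wtD[OF A shifts_wtD[OF B v refl refl]]) (use assms in simp_all)
  moreover have "B (A (C v)) \<in> wt (a + i'') (b + j'')"
    by (rule shifts_wtD[OF B shifts_wtD[OF A v refl refl]]) (use assms in simp_all)
  ultimately show "P v \<in> wt (a + i'') (b + j'')"
    by (simp add: eq wt_closed)
qed

lemma shifts_wt_ident: "shifts_wt (\<lambda>v. v) 0 0"
  by (simp add: shifts_wt_def)

lemma shifts_Psi_add:
  assumes "l + m > 0" "shifts_wt (Xp M l) i j" "shifts_wt (Xm M m) i' j'"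
  shows "shifts_wt (Psi M (l + m)) (i + i') (j + j')"
  by (rule shifts_wt_commutator[OF assms(2,3) shifts_wt_ident, where d = 1])
     (simp_all only: scale_one Psi_eq_commutator[OF assms(1)])

lemma shifts_Phi_add:
  assumes "l + m < 0" "shifts_wt (Xp M l) i j" "shifts_wt (Xm M m) i' j'"
  shows "shifts_wt (Phi M (l + m)) (i + i') (j + j')"
  by (rule shifts_wt_commutator[OF assms(2,3) shifts_wt_ident, where d = 1])
     (simp_all only: scale_one Phi_eq_commutator[OF assms(1)])

lemma shifts_Psi_1: "shifts_wt (Psi M 1) (- 1) (- 1)"
  using shifts_Psi_add[OF _ shifts_Xp_0 shifts_Xm_1] by simp

lemma shifts_Phi_minus_1: "shifts_wt (Phi M (- 1)) 1 1"
  using shifts_Phi_add[OF _ shifts_Xp_minus_1 shifts_Xm_0] by simp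

text \<open>Induction in both directions from \<open>x\<^sup>+(0)\<close>: \<open>\<psi>(1)\<close>
  has weight \<delta> and raises the mode by one, \<open>\<phi>(-1)\<close> has weight -\<delta> and
  lowers it.\<close>

lemma shifts_Xp: "shifts_wt (Xp M l) (- l) (- 1 - l)"
proof (induction l rule: int_induct[where k = 0])
  case base
  show ?case using shifts_Xp_0 by simp
next
  case (step1 i)
  show ?case
    by (rule shifts_wt_commutator[OF shifts_Psi_1 step1.IH shifts_Phi_0 Xp_succ]) simp_all
next
  case (step2 i)
  show ?case
    by (rule shifts_wt_commutator[OF shifts_Phi_minus_1 step2.IH shifts_Psi_0 Xp_pred]) simp_all
qed

lemma shifts_Xm: "shifts_wt (Xm M l) (- l) (1 - l)"
proof (induction l rule: int_induct[where k = 0])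
  case base
  show ?case using shifts_Xm_0 by simp
next
  case (step1 i)
  show ?case
    by (rule shifts_wt_commutator[OF shifts_Psi_1 step1.IH shifts_Phi_0 Xm_succ]) simp_all
next
  case (step2 i)
  show ?case
    by (rule shifts_wt_commutator[OF shifts_Phi_minus_1 step2.IH shifts_Psi_0 Xm_pred]) simp_all
qed

text \<open>For positive \<open>l\<close>, \<open>\<psi>(l)\<close> is a multiple of the commutator
  of \<open>x\<^sup>+(l)\<close> and \<open>x\<^sup>-(0)\<close>. All modes are covered so that the
  weight spaces can be shown to span a submodule.\<close>

lemma shifts_Psi: "shifts_wt (Psi M l) (- l) (- l)"
proof (cases l "0 :: int" rule: linorder_cases)
  case greater
  then show ?thesis using shifts_Psi_add[OF _ shifts_Xp[of l] shifts_Xm[of 0]] by simp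
next
  case equal
  with shifts_Psi_0 show ?thesis by simp
next
  case less
  then show ?thesis by (simp add: shifts_wt_def Psi_neg wt_closed(1))
qed

lemma shifts_Phi: "shifts_wt (Phi M l) (- l) (- l)"
proof (cases l "0 :: int" rule: linorder_cases)
  case less
  then show ?thesis using shifts_Phi_add[OF _ shifts_Xp[of l] shifts_Xm[of 0]] by simp
next
  case equal
  with shifts_Phi_0 show ?thesis by simp
next
  case greater
  then show ?thesis by (simp add: shifts_wt_def Phi_pos wt_closed(1))
qed

lemma shifts_Qc: "shifts_wt (Qc M l) 0 0"
  by (auto simp: shifts_wt_def Qc_eq wt_closed)

section \<open>Support and antisymmetry of the coefficients\<close>

text \<open>The span is stable under all generators and contains \<open>v0\<close>, so cyclicity
  makes it everything. This reduces the support bound to weight vectors.\<close>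

lemma span_wt: "span (\<Union>a b. wt a b) = UNIV"
proof -
  let ?S = "span (\<Union>a b. wt a b)"
  have closed: "T u \<in> ?S" if T: "shifts_wt T i j" "Vector_Spaces.linear (scl M) (scl M) T" and "u \<in> ?S"
    for T i j u
    using \<open>u \<in> ?S\<close>
  proof (induction rule: span_induct)
    show "subspace {u. T u \<in> ?S}"
      by (intro subspaceI) (auto simp: linear_simps[OF T(2)] span_add span_scale span_zero)
  next
    fix u assume "u \<in> (\<Union>a b. wt a b)"
    then obtain a b where "u \<in> wt a b"
      by blast
    with T(1) have "T u \<in> wt (a + i) (b + j)"
      by (simp add: shifts_wt_def)
    then show "T u \<in> ?S"
      by (intro span_base) blast
  qed
  have "v0 \<in> wt 0 0"
    using f_monomial_in_wt[OF f_monomials.base] by simp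
  then have "v0 \<in> ?S"
    by (intro span_base) blast
  moreover have "submodule M ?S"
    unfolding submodule_def
    using closed[OF shifts_Xp linear_Xp] closed[OF shifts_Xm linear_Xm]
      closed[OF shifts_Psi linear_Psi] closed[OF shifts_Phi linear_Phi]
      closed[OF shifts_Qc linear_Qc]
    by simp
  ultimately show ?thesis
    using highest_weight by (simp add: highest_weight_module_def)
qed

text \<open>The bound on \<open>m\<close> comes from \<open>v\<close> alone, the one on \<open>l + m\<close> from the finite support of \<open>\<xi>\<close>.\<close>

lemma correlation_support:
  assumes "\<xi> \<in> restricted_dual M v0"
  shows "\<exists>N :: nat. \<forall>l m. correlation M \<xi> v l m \<noteq> 0 \<longrightarrow> m \<le> int N \<and> \<bar>l + m\<bar> \<le> int N"
    (is "?P v")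
proof -
  have lin: "Vector_Spaces.linear (scl M) (*) \<xi>"
    and fin: "finite {(a, b). \<exists>u \<in> weight_space M v0 a b. \<xi> u \<noteq> 0}" (is "finite ?D")
    using assms by (auto simp: restricted_dual_def)
  note xi = linear_simps[OF lin]
  \<comment> \<open>Bounding the \<open>\<alpha>\<^sub>0\<close> index is enough:
    \<open>x\<^sup>+(l) x\<^sup>+(m)\<close> decreases it by exactly \<open>l + m\<close>.\<close>
  obtain B where B: "\<And>a b. (a, b) \<in> ?D \<Longrightarrow> a \<le> B"
    using finite_imageI[OF fin, of fst] unfolding finite_nat_set_iff_bounded_le
    by (metis (no_types, lifting) fst_conv imageI)
  have xi_wt: "a \<ge> 0 \<and> a \<le> int B" if "u \<in> wt a b" "\<xi> u \<noteq> 0" for u a b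
  proof -
    have "a \<ge> 0 \<and> b \<ge> 0"
      using that by (auto simp: wt_def xi split: if_splits)
    with that have "(nat a, nat b) \<in> ?D"
      by (auto simp: wt_def)
    with B \<open>a \<ge> 0 \<and> b \<ge> 0\<close> show ?thesis
      by fastforce
  qed
  have "v \<in> span (\<Union>a b. wt a b)"
    by (simp add: span_wt)
  then show ?thesis
  proof (induction rule: span_induct)
    show "subspace {v. ?P v}"
    proof (rule subspaceI)
      show "0 \<in> {v. ?P v}"
        by (simp add: correlation_def op_linear xi)
    next
      fix u v assume "u \<in> {v. ?P v}" "v \<in> {v. ?P v}"
      then obtain N N' :: nat where
        "\<And>l m. correlation M \<xi> u l m \<noteq> 0 \<Longrightarrow> m \<le> int N \<and> \<bar>l + m\<bar> \<le> int N"
        "\<And>l m. correlation M \<xi> v l m \<noteq> 0 \<Longrightarrow> m \<le> int N' \<and> \<bar>l + m\<bar> \<le> int N'"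
        by blast
      moreover have "correlation M \<xi> (u + v) l m = correlation M \<xi> u l m + correlation M \<xi> v l m" for l m
        by (simp add: correlation_def op_linear xi)
      ultimately have "m \<le> int (max N N') \<and> \<bar>l + m\<bar> \<le> int (max N N')"
        if "correlation M \<xi> (u + v) l m \<noteq> 0" for l m
        using that by (cases "correlation M \<xi> u l m = 0") fastforce+
      then show "u + v \<in> {v. ?P v}" by blast
    next
      fix c v assume "v \<in> {v. ?P v}"
      then show "scl M c v \<in> {v. ?P v}"
        by (fastforce simp: correlation_def op_linear xi)
    qed
  next
    fix u assume "u \<in> (\<Union>a b. wt a b)"
    then obtain a b where u: "u \<in> wt a b" by blast
    \<comment> \<open>The first index is \<open>a - m\<close> after \<open>x\<^sup>+(m)\<close>,
      where it must be nonnegative for a nonzero vector, and \<open>a - m - l\<close> after both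
      operators, where it must lie in the support of \<xi>.\<close>
    have "m \<le> a \<and> a - m - l \<ge> 0 \<and> a - m - l \<le> int B" if nz: "correlation M \<xi> u l m \<noteq> 0" for l m
    proof
      have 1: "Xp M m u \<in> wt (a - m) (b - 1 - m)"
        using u by (rule shifts_wtD[OF shifts_Xp]) auto
      show "m \<le> a"
        using nz 1 by (rule_tac ccontr) (simp add: wt_def correlation_def op_linear xi)
      have "Xp M l (Xp M m u) \<in> wt (a - m - l) (b - 1 - m - 1 - l)"
        using 1 by (rule shifts_wtD[OF shifts_Xp]) auto
      then show "a - m - l \<ge> 0 \<and> a - m - l \<le> int B"
        by (rule xi_wt) (use nz in \<open>simp add: correlation_def\<close>)
    qed
    then have "m \<le> int (nat \<bar>a\<bar> + B) \<and> \<bar>l + m\<bar> \<le> int (nat \<bar>a\<bar> + B)"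
      if "correlation M \<xi> u l m \<noteq> 0" for l m
      using that by fastforce
    then show "?P u" by blast
  qed
qed

text \<open>Multiplication by \<open>z\<close> or \<open>w\<close> raises the index \<open>l\<close>
  or \<open>m\<close> of the coefficient by one, so the left side is a coefficient of
  \<open>(z - q\<^sup>2 w) F\<close>. The two sides of the quadratic relation differ by a sign and
  the exchange of \<open>l\<close> and \<open>m\<close>.\<close>

lemma correlation_antisymmetry:
  assumes "\<xi> \<in> restricted_dual M v0"
  shows "correlation M \<xi> v (l + 1) m - q ^ 2 * correlation M \<xi> v l (m + 1) =
    - (correlation M \<xi> v (m + 1) l - q ^ 2 * correlation M \<xi> v m (l + 1))"
proof -
  have lin: "Vector_Spaces.linear (scl M) (*) \<xi>"
    using assms by (auto simp: restricted_dual_def)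
  show ?thesis
    using arg_cong[OF Xp_Xp[of l m v], of \<xi>]
    by (simp add: correlation_def linear_simps[OF lin])
qed

end

section \<open>Expansions of rational functions\<close>

lemma fls_nth_laurent_of_poly2:
  "fls_nth (fls_nth (laurent_of_poly2 p) n) j =
    (if n \<ge> 0 \<and> j \<ge> 0 then coeff (coeff p (nat n)) (nat j) else 0)"
  by (simp add: laurent_of_poly2_def fps_to_fls_nth coeff_map_poly)

lemma laurent_of_poly2_diff: "laurent_of_poly2 (p - r) = laurent_of_poly2 p - laurent_of_poly2 r"
  by (intro fls_eqI) (simp add: fls_nth_laurent_of_poly2)

lemma laurent_of_poly2_monom:
  "laurent_of_poly2 (monom (monom c i) j) = fls_const (fls_const c * fls_X ^ i) * fls_X ^ j"
  by (intro fls_eqI)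
     (auto simp: fls_nth_laurent_of_poly2 fls_X_power_times_conv_shift fls_const_nth)

lemma fls_nth_laurent_of_poly2_monom_times:
  "fls_nth (fls_nth (laurent_of_poly2 (monom (monom c i) j) * S) n) l =
    c * fls_nth (fls_nth S (n - int j)) (l - int i)"
  by (simp only: laurent_of_poly2_monom mult.assoc fls_X_power_times_conv_shift(1)
      fls_mult_const_nth fls_shift_nth) simp

lemma laurent_of_poly2_nonzero:
  assumes "p \<noteq> 0"
  shows "laurent_of_poly2 p \<noteq> 0"
proof
  assume *: "laurent_of_poly2 p = 0"
  have "coeff (coeff p n) j = 0" for n j
    using fls_nth_laurent_of_poly2[of p "int n" "int j"] by (simp add: *)
  with assms show False
    by (metis poly_eqI coeff_0)
qed

text \<open>Powers of \<open>w\<close> are bounded below by \<open>- N\<close>. For a fixed power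
  \<open>n\<close> of \<open>w\<close>, powers of \<open>z\<close> are bounded below by
  \<open>- n - N\<close>; this bound may depend on \<open>n\<close> in iterated Laurent
  series.\<close>

lemma fls_fls_of_coeffs:
  fixes F :: "int \<Rightarrow> int \<Rightarrow> K"
  assumes "\<And>l m. F l m \<noteq> 0 \<Longrightarrow> m \<le> N \<and> \<bar>l + m\<bar> \<le> N"
  obtains S :: "K fls fls" where "\<And>n j. fls_nth (fls_nth S n) j = F (- j) (- n)"
proof
  define S where "S = Abs_fls (\<lambda>n. Abs_fls (\<lambda>j. F (- j) (- n)))"
  have inner: "fls_nth (Abs_fls (\<lambda>j. F (- j) (- n))) j = F (- j) (- n)" for n j
    by (rule nth_Abs_fls_lower_bound[of "- n - N"]) (use assms in force)
  have "fls_nth S n = Abs_fls (\<lambda>j. F (- j) (- n))" for n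
    unfolding S_def
  proof (rule nth_Abs_fls_lower_bound[of "- N"])
    show "\<forall>n < - N. Abs_fls (\<lambda>j. F (- j) (- n)) = 0"
      by (intro allI impI fls_eqI) (use assms in \<open>force simp: inner\<close>)
  qed
  then show "fls_nth (fls_nth S n) j = F (- j) (- n)" for n j
    by (simp add: inner)
qed

lemma eval_poly2_diff: "eval_poly2 (p - r) z w = eval_poly2 p z w - eval_poly2 r z w"
proof -
  have 1: "map_poly to_ac (a - b) = map_poly to_ac a - (map_poly to_ac b :: K alg_closure poly)" for a b
    by (intro poly_eqI) (simp add: coeff_map_poly)
  have "map_poly (\<lambda>c. poly (map_poly to_ac c) z) (p - r) =
      map_poly (\<lambda>c. poly (map_poly to_ac c) z) p - map_poly (\<lambda>c. poly (map_poly to_ac c) z) r"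
    by (intro poly_eqI) (simp add: coeff_map_poly 1)
  then show ?thesis
    by (simp add: eval_poly2_def)
qed

lemma eval_poly2_monom: "eval_poly2 (monom (monom c i) j) z w = to_ac c * z ^ i * w ^ j"
  by (simp add: eval_poly2_def map_poly_monom poly_monom)

lemma coeff_sum_monom_atMost: "coeff (\<Sum>i\<le>n. monom (f i) i) j = (if j \<le> n then f j else 0)"
  by (simp add: coeff_sum)

text \<open>The antisymmetry turns the bound on \<open>m\<close> into a bound on \<open>l\<close>, so \<open>(z - c w) F\<close> has only
  finitely many coefficients.\<close>

lemma rational_of_antisymmetric:
  fixes F :: "int \<Rightarrow> int \<Rightarrow> K" and N :: nat and c :: K
  assumes supp: "\<And>l m. F l m \<noteq> 0 \<Longrightarrow> m \<le> int N \<and> \<bar>l + m\<bar> \<le> int N"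
    and antisym: "\<And>l m. F (l + 1) m - c * F l (m + 1) = - (F (m + 1) l - c * F m (l + 1))"
  shows "\<exists>A. is_expansion_of F
    (Fract A (monom (monom 1 (Suc N)) N - monom (monom c N) (Suc N)))"
proof -
  \<comment> \<open>These are the coefficients of \<open>(z - c w) F\<close>.\<close>
  define G where "G l m = F (l + 1) m - c * F l (m + 1)" for l m
  have G_antisym: "G l m = - G m l" for l m
    unfolding G_def by (rule antisym)
  have *: "m \<le> int N \<and> \<bar>l + m + 1\<bar> \<le> int N" if "G l m \<noteq> 0" for l m
  proof (cases "F (l + 1) m = 0")
    case True
    with that have "F l (m + 1) \<noteq> 0"
      by (auto simp: G_def)
    from supp[OF this] show ?thesis by linarith
  next
    case False
    from supp[OF this] show ?thesis by linarith
  qed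
  \<comment> \<open>Antisymmetry transfers the upper bound from \<open>m\<close> to
    \<open>l\<close>; together with the bound on \<open>l + m + 1\<close> this gives the lower
    bounds \<open>- 2 * N - 1\<close>.\<close>
  have G_bound: "\<bar>l\<bar> \<le> 2 * int N + 1 \<and> \<bar>m\<bar> \<le> 2 * int N + 1 \<and> l \<le> int N \<and> m \<le> int N"
    if "G l m \<noteq> 0" for l m
    using *[OF that] *[of m l] that G_antisym[of l m] by auto
  \<comment> \<open>This is \<open>z\<^sup>N w\<^sup>N (z - c w)\<close>; the monomial clears all
    negative exponents, since \<open>l\<close> and \<open>m\<close> are at most \<open>N\<close> in
    the support of \<open>G\<close>.\<close>
  define B where "B = monom (monom 1 (Suc N)) N - monom (monom c N) (Suc N)"
  \<comment> \<open>The exponent of \<open>z\<close> is \<open>N - l\<close>, and \<open>l\<close>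
    is at least \<open>- 2 * N - 1\<close>, whence the range up to \<open>3 * N + 1\<close>;
    likewise for \<open>w\<close>.\<close>
  define A where "A = (\<Sum>j\<le>3 * N + 1. monom
    (\<Sum>i\<le>3 * N + 1. monom (G (int N - int i) (int N - int j)) i) j)"
  have coeff_A: "coeff (coeff A j) i = G (int N - int i) (int N - int j)" for i j
  proof -
    have "coeff (coeff A j) i =
        (if j \<le> 3 * N + 1 \<and> i \<le> 3 * N + 1 then G (int N - int i) (int N - int j) else 0)"
      unfolding A_def
      by (simp add: coeff_sum_monom_atMost del: sum.atMost_Suc)
    also have "\<dots> = G (int N - int i) (int N - int j)"
      using G_bound[of "int N - int i" "int N - int j"]
      by (cases "G (int N - int i) (int N - int j) = 0") auto
    finally show ?thesis .
  qed
  obtain S :: "K fls fls" where S: "\<And>n j. fls_nth (fls_nth S n) j = F (- j) (- n)"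
    using fls_fls_of_coeffs supp by metis
  have B_nonzero: "B \<noteq> 0"
  proof -
    have "coeff (coeff B N) (Suc N) = 1"
      by (simp add: B_def)
    then show ?thesis by auto
  qed
  have "laurent_of_poly2 B * S = laurent_of_poly2 A"
  proof (intro fls_eqI)
    fix n j
    have "fls_nth (fls_nth (laurent_of_poly2 B * S) n) j =
        G (int N - j) (int N - n)"
      by (simp add: B_def laurent_of_poly2_diff left_diff_distrib
          fls_nth_laurent_of_poly2_monom_times S G_def) (simp add: algebra_simps)
    also have "\<dots> = fls_nth (fls_nth (laurent_of_poly2 A) n) j"
      using G_bound[of "int N - j" "int N - n"]
      by (cases "G (int N - j) (int N - n) = 0") (auto simp: fls_nth_laurent_of_poly2 coeff_A)
    finally show "fls_nth (fls_nth (laurent_of_poly2 B * S) n) j =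
      fls_nth (fls_nth (laurent_of_poly2 A) n) j" .
  qed
  then have "laurent_of_poly2 A / laurent_of_poly2 B = S"
    using laurent_of_poly2_nonzero[OF B_nonzero] by (metis nonzero_mult_div_cancel_left)
  then have "is_expansion_of F (Fract A B)"
    unfolding is_expansion_of_def using B_nonzero S by (intro exI[of _ A] exI[of _ B]) simp
  then show ?thesis
    unfolding B_def by blast
qed

section \<open>Poles of the correlation functions\<close>

theorem proposition5:
  fixes M :: "'v::ab_group_add uq_rep" and k :: nat and v0 v :: 'v and \<xi> :: "'v \<Rightarrow> K"
  assumes "k \<ge> 1"
    and "uq_module M"
    and "has_level M k"
    and "integrable_highest_weight_module M v0"
    and "\<xi> \<in> restricted_dual M v0"
  shows "\<exists>R. is_expansion_of (correlation M \<xi> v) R \<and>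
    (\<forall>z w. z \<noteq> 0 \<longrightarrow> w \<noteq> 0 \<longrightarrow> is_pole_at R z w \<longrightarrow> z * inverse (to_ac q ^ 2) = w)"
proof -
  obtain n0 n1 where "highest_weight_module M v0 n0 n1"
    using assms(4) by (auto simp: integrable_highest_weight_module_def)
  then interpret uq_highest_weight_module M k v0 n0 n1
    using assms(2,3)
    by (intro uq_highest_weight_module.intro uq_level_module.intro
        uq_level_module_axioms.intro uq_highest_weight_module_axioms.intro)
  obtain N :: nat where
    N: "\<And>l m. correlation M \<xi> v l m \<noteq> 0 \<Longrightarrow> m \<le> int N \<and> \<bar>l + m\<bar> \<le> int N"
    using correlation_support[OF assms(5)] by blast
  define B :: "K poly poly"
    where "B = monom (monom 1 (Suc N)) N - monom (monom (q ^ 2) N) (Suc N)"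
  obtain A where A: "is_expansion_of (correlation M \<xi> v) (Fract A B)"
    using rational_of_antisymmetric[where F = "correlation M \<xi> v", OF N correlation_antisymmetry[OF assms(5)]]
    unfolding B_def by blast
  have "z * inverse (to_ac q ^ 2) = w"
    if "z \<noteq> 0" "w \<noteq> 0" "is_pole_at (Fract A B) z w" for z w
  proof -
    \<comment> \<open>Otherwise this very representation of the fraction would show that the point
      is not a pole.\<close>
    have "eval_poly2 B z w = 0"
      using that(3) unfolding is_pole_at_def by blast
    \<comment> \<open>The monomial factor vanishes only on the coordinate axes, which are
      excluded.\<close>
    moreover have "eval_poly2 B z w = z ^ N * w ^ N * (z - to_ac q ^ 2 * w)"
      unfolding B_def by (simp add: eval_poly2_diff eval_poly2_monom algebra_simps)
    ultimately have "z = to_ac q ^ 2 * w"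
      using that by simp
    then show ?thesis
      using q_nonzero by simp
  qed
  with A show ?thesis
    by blast
qed

end
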